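(* Let $\mathfrak k$ be a Lie subalgebra of $W$ of finite codimension. Then (a) there exists $f\in\Bbbk[t,t^{-1}]\setminus\{0\}$ such that $W(\mathrm{rad}(f))\supseteq\mathfrak k\supseteq W(f)$; (b) we can choose $f$ satisfying (a) so that $f\in\Bbbk[t]$, $f$ is monic and $f(0)\neq0$; (c) if we assume moreover that $f$ is of minimal degree, then such a choice of $f$ is unique.
   Context: $\Bbbk$ is an uncountable algebraically closed field of characteristic $0$; $\partial=d/dt$. $W=\Bbbk[t,t^{-1}]\partial$ is the Witt algebra, with $[f\partial,g\partial]=(fg'-f'g)\partial$. For $f\in\Bbbk[t,t^{-1}]$, $W(f)=f\,\Bbbk[t,t^{-1}]\partial\subseteq W$, and for nonzero $f$, $\mathrm{rad}(f)=\prod\{(t-x): x\in\Bbbk^\times,\ f(x)=0\}$. *)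

theory Defs
  imports
    "HOL-Computational_Algebra.Polynomial"
    "HOL-Library.Countable_Set"
    "HOL-Library.Poly_Mapping"
begin

text \<open>
  The Laurent polynomial ring \<open>\<k>[t,t\<inverse>]\<close> is the group algebra of the integers: finitely supported
  functions \<open>int \<Rightarrow> \<k>\<close> with convolution as multiplication; \<open>Poly_Mapping.single n c\<close> is \<open>c t\<^sup>n\<close>.
\<close>

type_synonym 'k laurent = "int \<Rightarrow>\<^sub>0 'k"

definition laurent_scale :: "'k::comm_ring_1 \<Rightarrow> 'k laurent \<Rightarrow> 'k laurent" where
  "laurent_scale c f = Poly_Mapping.single 0 c * f"

global_interpretation laurent: vector_space "laurent_scale :: 'k::field \<Rightarrow> 'k laurent \<Rightarrow> 'k laurent"
  defines laurent_span = laurent.span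
    and laurent_subspace = laurent.subspace
  by unfold_locales
    (simp_all add: laurent_scale_def distrib_left distrib_right single_add mult_single
      flip: mult.assoc)

lift_definition laurent_deriv :: "'k::comm_ring_1 laurent \<Rightarrow> 'k laurent"
  is "\<lambda>f n. of_int (n + 1) * f (n + 1)"
proof -
  fix f :: "int \<Rightarrow> 'k"
  assume "finite {n. f n \<noteq> 0}"
  then have "finite ((\<lambda>n. n - 1) ` {n. f n \<noteq> 0})"
    by (rule finite_imageI)
  moreover have "{n. of_int (n + 1) * f (n + 1) \<noteq> 0} \<subseteq> (\<lambda>n. n - 1) ` {n. f n \<noteq> 0}"
    by (auto intro!: image_eqI [where x = "_ + 1"])
  ultimately show "finite {n. of_int (n + 1) * f (n + 1) \<noteq> 0}"
    by (rule finite_subset [rotated])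
qed

text \<open>Only meaningful for \<open>x \<noteq> 0\<close>.\<close>

definition laurent_eval :: "'k::field laurent \<Rightarrow> 'k \<Rightarrow> 'k" where
  "laurent_eval f x = (\<Sum>n\<in>Poly_Mapping.keys f. Poly_Mapping.lookup f n * x powi n)"

definition laurent_of_poly :: "'k::comm_ring_1 poly \<Rightarrow> 'k laurent" where
  "laurent_of_poly p = (\<Sum>i\<le>degree p. Poly_Mapping.single (int i) (coeff p i))"

text \<open>Only meaningful for \<open>f \<noteq> 0\<close>, when the product is over a finite set.\<close>

definition laurent_rad :: "'k::field laurent \<Rightarrow> 'k laurent" where
  "laurent_rad f =
    (\<Prod>x\<in>{x. x \<noteq> 0 \<and> laurent_eval f x = 0}. Poly_Mapping.single 1 1 - Poly_Mapping.single 0 x)"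

text \<open>
  The Witt algebra is the free \<open>\<k>[t,t\<inverse>]\<close>-module on \<open>\<partial>\<close>, so the element \<open>f\<partial>\<close> is represented by its
  coefficient \<open>f\<close>, and the whole algebra by \<open>UNIV\<close>.
\<close>

definition witt_bracket :: "'k::comm_ring_1 laurent \<Rightarrow> 'k laurent \<Rightarrow> 'k laurent" where
  "witt_bracket f g = f * laurent_deriv g - laurent_deriv f * g"

definition witt_lie_subalgebra :: "'k::field laurent set \<Rightarrow> bool" where
  "witt_lie_subalgebra K \<longleftrightarrow>
    laurent_subspace K \<and> (\<forall>f\<in>K. \<forall>g\<in>K. witt_bracket f g \<in> K)"

text \<open>The quotient of \<open>UNIV\<close> by the subspace \<open>K\<close> is spanned by the classes of a finite set.\<close>

definition witt_finite_codim :: "'k::field laurent set \<Rightarrow> bool" where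
  "witt_finite_codim K \<longleftrightarrow> (\<exists>B. finite B \<and> laurent_span (K \<union> B) = UNIV)"

definition W_mult :: "'k::comm_ring_1 laurent \<Rightarrow> 'k laurent set" where
  "W_mult f = {f * g | g. True}"

definition rad_sandwich :: "'k::field laurent set \<Rightarrow> 'k laurent \<Rightarrow> bool" where
  "rad_sandwich K f \<longleftrightarrow> f \<noteq> 0 \<and> W_mult f \<subseteq> K \<and> K \<subseteq> W_mult (laurent_rad f)"

definition normalized_rad_sandwich :: "'k::field laurent set \<Rightarrow> 'k poly \<Rightarrow> bool" where
  "normalized_rad_sandwich K p \<longleftrightarrow>
    rad_sandwich K (laurent_of_poly p) \<and> lead_coeff p = 1 \<and> poly p 0 \<noteq> 0"

text \<open>The bracket is the commutator of the derivations \<open>f\<partial>\<close> and \<open>g\<partial>\<close>.\<close>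

lemma laurent_deriv_diff: "laurent_deriv (f - g) = laurent_deriv f - laurent_deriv g"
  by (rule poly_mapping_eqI) (simp add: laurent_deriv.rep_eq lookup_minus algebra_simps)

lemma laurent_deriv_add: "laurent_deriv (f + g) = laurent_deriv f + laurent_deriv g"
  by (rule poly_mapping_eqI) (simp add: laurent_deriv.rep_eq lookup_add algebra_simps)

lemma laurent_deriv_single:
  "laurent_deriv (Poly_Mapping.single n c) = Poly_Mapping.single (n - 1) (of_int n * c)"
  by (rule poly_mapping_eqI) (auto simp: laurent_deriv.rep_eq lookup_single when_def)

lemma laurent_induct [case_names single add]:
  fixes f :: "'k::comm_ring_1 laurent"
  assumes single: "\<And>n c. P (Poly_Mapping.single n c)"
    and add: "\<And>f g. P f \<Longrightarrow> P g \<Longrightarrow> P (f + g)"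
  shows "P f"
proof (rule update_induct [of P])
  show "P 0" using single [of 0 0] by simp
next
  fix f :: "'k laurent" and n :: int and c :: 'k
  assume "n \<notin> Poly_Mapping.keys f" and f: "P f"
  then have "Poly_Mapping.update n c f = Poly_Mapping.single n c + f"
    by (intro poly_mapping_eqI)
      (auto simp: lookup_update lookup_add lookup_single when_def in_keys_iff)
  then show "P (Poly_Mapping.update n c f)"
    using add [OF single f] by simp
qed

lemma laurent_deriv_mult:
  "laurent_deriv (f * g) = laurent_deriv f * g + f * laurent_deriv g"
proof (induction f rule: laurent_induct)
  case (single m c)
  show ?case
  proof (induction g rule: laurent_induct)
    case (single n d)
    have "m - 1 + n = m + n - 1" "m + (n - 1) = m + n - 1" by simp_all
    then show ?case
      by (simp add: laurent_deriv_single mult_single algebra_simps flip: single_add)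
  next
    case (add f' g')
    then show ?case by (simp add: laurent_deriv_add algebra_simps)
  qed
next
  case (add f' g')
  then show ?case by (simp add: laurent_deriv_add algebra_simps)
qed

lemma witt_bracket_commutator:
  "witt_bracket f g * laurent_deriv h =
    f * laurent_deriv (g * laurent_deriv h) - g * laurent_deriv (f * laurent_deriv h)"
  by (simp add: witt_bracket_def laurent_deriv_mult algebra_simps)

lemma witt_bracket_self: "witt_bracket f f = 0"
  by (simp add: witt_bracket_def algebra_simps)

lemma witt_bracket_Jacobi:
  "witt_bracket f (witt_bracket g h) + witt_bracket g (witt_bracket h f) +
    witt_bracket h (witt_bracket f g) = 0"
  by (simp add: witt_bracket_def laurent_deriv_mult laurent_deriv_diff algebra_simps)

end

theory Submission
  imports Defs
begin

text \<open>
  The proof compares \<open>K\<close> with the largest ideal \<open>I\<close> of the Laurent polynomial ring that it contains.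
  Because \<open>t\<close> is a unit, \<open>I\<close> is determined by the polynomials \<open>p\<close> with \<open>W(p) \<subseteq> K\<close>, and these form an
  ideal of \<open>\<k>[t]\<close>, here \<open>ideal_generators K\<close>. The required polynomial is the monic generator of
  this ideal.

  The ideal is not zero. By finite codimension, the elements \<open>f \<in> K\<close> whose brackets with all of \<open>W\<close>
  lie in \<open>K\<close> form a subspace cut out by finitely many linear conditions, so it contains two
  polynomials \<open>a\<close>, \<open>b\<close> of different positive degrees. For every \<open>g\<close>, the identity
  \<open>[a, b g] - [b, a g] = 2 [a, b] g\<close> (\<open>witt_bracket_mult_shift\<close>) then shows \<open>[a, b] g \<in> K\<close>. Thus
  \<open>[a, b]\<close>, which is the Wronskian \<open>a b' - a' b\<close>, belongs to the ideal, and it is nonzero because the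
  degrees differ (\<open>ideal_generators_nontrivial\<close>).

  Let \<open>p\<close> be the monic generator. Dividing by \<open>t\<close> does not leave the ideal, so \<open>p(0) \<noteq> 0\<close>. For
  \<open>k \<in> K\<close>, Leibniz' rule writes \<open>k p' h\<close> as \<open>[k, p h]\<close> minus a multiple of \<open>p\<close>, so \<open>k p'\<close> multiplies every
  \<open>h\<close> into \<open>K\<close>, and hence \<open>p\<close> divides \<open>k p'\<close>. At a root of \<open>p\<close> the derivative has order one less than
  \<open>p\<close> in characteristic zero, so \<open>k\<close> must vanish there. Therefore every element of \<open>K\<close> is a multiple of the
  radical of \<open>p\<close> (\<open>monic_generator_rad_sandwich\<close>).

  Every other choice of \<open>f\<close> is a multiple of \<open>p\<close>; if it is monic of the same degree, it equals \<open>p\<close>.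
\<close>

section \<open>Polynomials as Laurent polynomials\<close>

lemma lookup_laurent_of_poly:
  "Poly_Mapping.lookup (laurent_of_poly p) n = (if 0 \<le> n then coeff p (nat n) else 0)"
proof -
  have "Poly_Mapping.lookup (laurent_of_poly p) n =
      (\<Sum>i\<le>degree p. if i = nat n \<and> 0 \<le> n then coeff p i else 0)"
    unfolding laurent_of_poly_def lookup_sum
    by (rule sum.cong) (auto simp: lookup_single when_def)
  also have "\<dots> = (if 0 \<le> n then coeff p (nat n) else 0)"
    by (cases "0 \<le> n") (auto simp: sum.delta coeff_eq_0)
  finally show ?thesis .
qed

lemma laurent_of_poly_0 [simp]: "laurent_of_poly 0 = 0"
  by (rule poly_mapping_eqI) (simp add: lookup_laurent_of_poly)

lemma laurent_of_poly_add: "laurent_of_poly (p + q) = laurent_of_poly p + laurent_of_poly q"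
  by (rule poly_mapping_eqI) (simp add: lookup_laurent_of_poly lookup_add)

lemma laurent_of_poly_diff: "laurent_of_poly (p - q) = laurent_of_poly p - laurent_of_poly q"
  by (rule poly_mapping_eqI) (simp add: lookup_laurent_of_poly lookup_minus)

lemma laurent_of_poly_monom: "laurent_of_poly (monom c n) = Poly_Mapping.single (int n) c"
  by (rule poly_mapping_eqI) (auto simp: lookup_laurent_of_poly lookup_single when_def)

lemma laurent_of_poly_pCons:
  "laurent_of_poly (pCons a p) =
    Poly_Mapping.single 0 a + Poly_Mapping.single 1 1 * laurent_of_poly p"
proof -
  have shift: "Poly_Mapping.single 1 1 * laurent_of_poly p = laurent_of_poly (pCons 0 p)"
  proof (rule poly_mapping_eqI)
    fix n :: int
    have "Poly_Mapping.lookup (Poly_Mapping.single 1 1 * laurent_of_poly p) n =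
        Poly_Mapping.lookup (laurent_of_poly p) (n - 1)"
    proof -
      have "Poly_Mapping.lookup (Poly_Mapping.single 1 1 * f) n = Poly_Mapping.lookup f (n - 1)"
        for f :: "'a laurent"
        by (induction f rule: laurent_induct)
          (auto simp: mult_single lookup_single when_def distrib_left lookup_add)
      then show ?thesis .
    qed
    then show "Poly_Mapping.lookup (Poly_Mapping.single 1 1 * laurent_of_poly p) n =
        Poly_Mapping.lookup (laurent_of_poly (pCons 0 p)) n"
      by (auto simp: lookup_laurent_of_poly coeff_pCons nat_diff_distrib split: nat.split)
  qed
  have "pCons a p = monom a 0 + pCons 0 p"
    by (simp add: monom_0)
  then show ?thesis
    by (simp only: laurent_of_poly_add laurent_of_poly_monom shift of_nat_0)
qed

lemma laurent_of_poly_smult: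
  "laurent_of_poly (smult c p) = Poly_Mapping.single 0 c * laurent_of_poly p"
  by (induction p)
    (simp_all add: laurent_of_poly_pCons distrib_left mult_single mult.left_commute)

lemma laurent_of_poly_mult: "laurent_of_poly (p * q) = laurent_of_poly p * laurent_of_poly q"
  by (induction p)
    (simp_all add: laurent_of_poly_pCons laurent_of_poly_add laurent_of_poly_smult
      distrib_right mult.assoc)

lemma laurent_of_poly_1: "laurent_of_poly 1 = 1"
  using laurent_of_poly_monom [of 1 0] by (simp add: monom_eq_1)

lemma laurent_of_poly_prod:
  "laurent_of_poly (\<Prod>x\<in>A. p x) = (\<Prod>x\<in>A. laurent_of_poly (p x))"
  by (induction A rule: infinite_finite_induct)
    (simp_all add: laurent_of_poly_1 laurent_of_poly_mult)

lemma laurent_of_poly_eq_0_iff [simp]: "laurent_of_poly p = 0 \<longleftrightarrow> p = 0"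
proof
  assume "laurent_of_poly p = 0"
  then have "coeff p n = 0" for n
    using lookup_laurent_of_poly [of p "int n"] by simp
  then show "p = 0" by (simp add: poly_eq_iff)
qed simp

lemma laurent_deriv_of_poly: "laurent_deriv (laurent_of_poly p) = laurent_of_poly (pderiv p)"
proof (rule poly_mapping_eqI)
  fix n :: int
  consider "n < - 1" | "n = - 1" | "0 \<le> n" by linarith
  then show "Poly_Mapping.lookup (laurent_deriv (laurent_of_poly p)) n =
      Poly_Mapping.lookup (laurent_of_poly (pderiv p)) n"
    by cases
      (simp_all add: laurent_deriv.rep_eq lookup_laurent_of_poly coeff_pderiv nat_add_distrib
        add.commute)
qed

lemma witt_bracket_of_poly:
  "witt_bracket (laurent_of_poly p) (laurent_of_poly q) =
    laurent_of_poly (p * pderiv q - pderiv p * q)"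
  by (simp add: witt_bracket_def laurent_deriv_of_poly laurent_of_poly_mult laurent_of_poly_diff)

lemma laurent_eval_of_poly: "laurent_eval (laurent_of_poly p) x = poly p x"
proof -
  have "laurent_eval (laurent_of_poly p) x =
      (\<Sum>n\<in>int ` {..degree p}. Poly_Mapping.lookup (laurent_of_poly p) n * x powi n)"
    unfolding laurent_eval_def
  proof (rule sum.mono_neutral_left)
    show "Poly_Mapping.keys (laurent_of_poly p) \<subseteq> int ` {..degree p}"
      by (auto simp: in_keys_iff lookup_laurent_of_poly image_iff le_degree
          intro!: bexI [of _ "nat _"] split: if_splits)
  qed (auto simp: in_keys_iff)
  also have "\<dots> = (\<Sum>i\<le>degree p. coeff p i * x ^ i)"
    by (subst sum.reindex) (auto simp: lookup_laurent_of_poly)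
  finally show ?thesis by (simp add: poly_altdef)
qed

text \<open>
  The condition at 0 makes the nonzero roots, over which the radical is taken, all the roots of \<open>p\<close>.
\<close>

lemma laurent_rad_of_poly:
  fixes p :: "'k::field poly"
  assumes "poly p 0 \<noteq> 0"
  shows "laurent_rad (laurent_of_poly p) = laurent_of_poly (\<Prod>x | poly p x = 0. [:- x, 1:])"
proof -
  have "{x. x \<noteq> 0 \<and> laurent_eval (laurent_of_poly p) x = 0} = {x. poly p x = 0}"
    using assms by (auto simp: laurent_eval_of_poly)
  moreover have "laurent_of_poly [:- x, 1:] = Poly_Mapping.single 1 1 - Poly_Mapping.single 0 x"
    for x :: 'k
    by (rule poly_mapping_eqI)
      (auto simp: lookup_laurent_of_poly lookup_single when_def lookup_minus coeff_pCons
        split: nat.split)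
  ultimately show ?thesis
    unfolding laurent_rad_def laurent_of_poly_prod by simp
qed

text \<open>
  A power of \<open>t\<close> clears the finitely many negative exponents. Statements about Laurent polynomials
  thus become statements about polynomials up to a unit.
\<close>

lemma laurent_eq_single_mult_of_poly:
  fixes f :: "'k::comm_ring_1 laurent"
  obtains n q where "f = Poly_Mapping.single (- int n) 1 * laurent_of_poly q"
proof -
  have "\<exists>n q. f = Poly_Mapping.single (- int n) 1 * laurent_of_poly q"
  proof (induction f rule: laurent_induct)
    case (single m c)
    have "Poly_Mapping.single m c =
        Poly_Mapping.single (- int (nat (- m))) 1 * laurent_of_poly (monom c (nat m))"
      by (simp add: laurent_of_poly_monom mult_single)
    then show ?case by blast
  next
    case (add f g)
    obtain m p n q where
      f: "f = Poly_Mapping.single (- int m) 1 * laurent_of_poly p" and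
      g: "g = Poly_Mapping.single (- int n) 1 * laurent_of_poly q"
      using add by blast
    have "f + g = Poly_Mapping.single (- int (m + n)) 1 *
        laurent_of_poly (monom 1 n * p + monom 1 m * q)"
      by (simp add: f g laurent_of_poly_add laurent_of_poly_mult laurent_of_poly_monom
          distrib_left mult_single flip: mult.assoc)
    then show ?case by blast
  qed
  then show thesis using that by blast
qed

section \<open>Elements in the kernel of finitely many functionals\<close>

text \<open>
  A basis of \<open>K\<close> extends to a basis of the whole space by adding vectors of the given finite spanning set
  of the quotient. The coordinates along the added vectors are the functionals.

  The point of passing to functionals is that further linear conditions, such as \<open>[f, b] \<in> K\<close> for
  fixed \<open>b\<close>, turn into additional functionals by composition.
\<close>

lemma finite_codim_common_kernel:
  fixes K :: "'k::field laurent set"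
  assumes sub: "laurent_subspace K" and codim: "witt_finite_codim K"
  obtains \<Phi> where "finite \<Phi>" "\<forall>\<phi>\<in>\<Phi>. Vector_Spaces.linear laurent_scale (*) \<phi>"
    "\<forall>f. (\<forall>\<phi>\<in>\<Phi>. \<phi> f = 0) \<longrightarrow> f \<in> K"
proof -
  obtain B where "finite B" and span_B: "laurent_span (K \<union> B) = UNIV"
    using codim by (auto simp: witt_finite_codim_def)
  obtain C where C: "C \<subseteq> K" "laurent.independent C" "K \<subseteq> laurent_span C"
    using laurent.maximal_independent_subset_extend [of "{}" K]
    by (metis empty_subsetI laurent.independent_empty)
  obtain D where D: "C \<subseteq> D" "D \<subseteq> K \<union> B" "laurent.independent D" "K \<union> B \<subseteq> laurent_span D"
    using laurent.maximal_independent_subset_extend [of C "K \<union> B"] C by auto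
  have span_D: "laurent_span D = UNIV"
    using laurent.span_mono [OF D(4)] span_B by (simp add: laurent.span_span top.extremum_unique)
  \<comment> \<open>A basis vector outside C that lay in K would depend on C.\<close>
  have "c \<notin> K" if "c \<in> D - C" for c
  proof
    assume "c \<in> K"
    then have "c \<in> laurent_span (D - {c})"
      using C(3) laurent.span_mono [of C "D - {c}"] D(1) that by auto
    then show False
      using D(3) that by (auto simp: laurent.dependent_def)
  qed
  then have "finite (D - C)"
    using D(2) \<open>finite B\<close> by (auto intro: finite_subset [of _ B])
  show thesis
  proof
    show "finite ((\<lambda>c f. laurent.representation D f c) ` (D - C))"
      using \<open>finite (D - C)\<close> by simp
    show "\<forall>\<phi>\<in>(\<lambda>c f. laurent.representation D f c) ` (D - C).
        Vector_Spaces.linear laurent_scale (*) \<phi>"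
    proof -
      have "vector_space ((*) :: 'k \<Rightarrow> 'k \<Rightarrow> 'k)"
        by unfold_locales (simp_all add: algebra_simps)
      then show ?thesis
        using D(3) span_D
        by (auto simp: Vector_Spaces.linear_iff laurent.vector_space_axioms
            laurent.representation_add laurent.representation_scale)
    qed
    show "\<forall>f. (\<forall>\<phi>\<in>(\<lambda>c f. laurent.representation D f c) ` (D - C). \<phi> f = 0) \<longrightarrow> f \<in> K"
    proof (intro allI impI)
      fix f
      assume zero: "\<forall>\<phi>\<in>(\<lambda>c f. laurent.representation D f c) ` (D - C). \<phi> f = 0"
      have "laurent.representation D f b = 0 \<or> b \<in> C" for b
        using zero laurent.representation_ne_zero [of D f b] by (cases "b \<in> D") auto
      then have "(\<Sum>b | laurent.representation D f b \<noteq> 0.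
          laurent_scale (laurent.representation D f b) b) \<in> K"
        using C(1) by (intro laurent.subspace_sum sub laurent.subspace_scale) auto
      then show "f \<in> K"
        using laurent.sum_nonzero_representation_eq [OF D(3), of f] span_D by simp
    qed
  qed
qed

text \<open>
  One functional at a time: two polynomials of different degrees in the kernel of the earlier functionals
  have a nonzero combination in the kernel of the next one. Asking for divisibility by an arbitrarily
  high power of \<open>t\<close> keeps a polynomial of larger degree available at every stage.
\<close>

lemma nonzero_poly_in_common_kernel:
  fixes \<Phi> :: "('k::field laurent \<Rightarrow> 'k) set"
  assumes "finite \<Phi>" and "\<And>\<phi>. \<phi> \<in> \<Phi> \<Longrightarrow> Vector_Spaces.linear laurent_scale (*) \<phi>"
  shows "\<exists>a. a \<noteq> 0 \<and> monom 1 m dvd a \<and> (\<forall>\<phi>\<in>\<Phi>. \<phi> (laurent_of_poly a) = 0)"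
  using assms
proof (induction \<Phi> arbitrary: m rule: finite_induct)
  case empty
  show ?case by (intro exI [of _ "monom 1 m"]) (simp add: monom_eq_0_iff)
next
  case (insert \<phi> \<Phi>)
  note lin = insert.prems
  obtain a where a: "a \<noteq> 0" "monom 1 m dvd a" "\<forall>\<psi>\<in>\<Phi>. \<psi> (laurent_of_poly a) = 0"
    using insert.IH [of m] lin by auto
  obtain b where b: "b \<noteq> 0" "monom 1 (Suc (max m (degree a))) dvd b"
      "\<forall>\<psi>\<in>\<Phi>. \<psi> (laurent_of_poly b) = 0"
    using insert.IH [of "Suc (max m (degree a))"] lin by auto
  show ?case
  proof (cases "\<phi> (laurent_of_poly a) = 0")
    case True
    then show ?thesis using a by auto
  next
    case False
    define c where "c = \<phi> (laurent_of_poly b) / \<phi> (laurent_of_poly a)"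
    have comb: "\<psi> (laurent_of_poly (b - smult c a)) =
        \<psi> (laurent_of_poly b) - c * \<psi> (laurent_of_poly a)" if "\<psi> \<in> insert \<phi> \<Phi>" for \<psi>
    proof -
      interpret Vector_Spaces.linear laurent_scale "(*)" \<psi> by (rule lin [OF that])
      show ?thesis
        by (simp add: laurent_of_poly_diff laurent_of_poly_smult diff scale flip: laurent_scale_def)
    qed
    have "degree a < degree b"
      using dvd_imp_degree_le [OF b(2,1)] by (simp add: degree_monom_eq)
    then have "b - smult c a \<noteq> 0"
      using degree_smult_le [of c a] by auto
    moreover have "monom 1 m dvd b - smult c a"
    proof -
      have "monom (1 :: 'k) m dvd monom 1 (Suc (max m (degree a)))"
        by (intro dvdI [of _ _ "monom 1 (Suc (max m (degree a)) - m)"]) (simp add: mult_monom)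
      then show ?thesis
        using a(2) b(2) by (meson dvd_diff dvd_smult dvd_trans)
    qed
    moreover have "\<psi> (laurent_of_poly (b - smult c a)) = 0" if "\<psi> \<in> insert \<phi> \<Phi>" for \<psi>
      unfolding comb [OF that] using that a(3) b(3) False by (auto simp: c_def)
    ultimately show ?thesis by blast
  qed
qed

section \<open>The ideals contained in a subalgebra of finite codimension\<close>

text \<open>
  The leading terms of \<open>a b'\<close> and \<open>a' b\<close> have the coefficients of \<open>a b\<close> multiplied by \<open>deg b\<close> and \<open>deg a\<close>,
  so they cannot cancel.
\<close>

lemma poly_wronskian_nonzero:
  fixes a b :: "'k::field_char_0 poly"
  assumes "0 < degree a" "degree a < degree b"
  shows "a * pderiv b - pderiv a * b \<noteq> 0"
proof -
  have lead: "lead_coeff (pderiv p) = of_nat (degree p) * lead_coeff p"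
    if "0 < degree p" for p :: "'k poly"
    using that by (simp add: degree_pderiv coeff_pderiv)
  have "lead_coeff (a * pderiv b) - lead_coeff (pderiv a * b) =
      (of_nat (degree b) - of_nat (degree a)) * (lead_coeff a * lead_coeff b)"
    using assms by (simp add: lead_coeff_mult lead algebra_simps)
  then have "lead_coeff (a * pderiv b) \<noteq> lead_coeff (pderiv a * b)"
    using assms by auto
  then show ?thesis by auto
qed

text \<open>
  This identity produces ideals inside a Lie subalgebra: the left-hand side uses brackets only, whereas
  the right-hand side is the multiple of a fixed element by an arbitrary \<open>h\<close>.
\<close>

lemma witt_bracket_mult_shift:
  "witt_bracket f (g * h) - witt_bracket g (f * h) = 2 * (witt_bracket f g * h)"
  by (simp add: witt_bracket_def laurent_deriv_mult algebra_simps)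

lemma linear_witt_bracket:
  fixes g :: "'k::field laurent"
  shows "Vector_Spaces.linear laurent_scale laurent_scale (\<lambda>f. witt_bracket f g)"
proof -
  have const: "laurent_deriv (Poly_Mapping.single 0 c) = 0" for c :: 'k
    by (simp add: laurent_deriv_single)
  show ?thesis
    by (simp add: Vector_Spaces.linear_iff laurent.vector_space_axioms witt_bracket_def
      laurent_deriv_add laurent_scale_def laurent_deriv_mult const algebra_simps)
qed

lemma subspace_witt_bracket_into:
  fixes K :: "'k::field laurent set"
  assumes "laurent_subspace K"
  shows "laurent_subspace {g. witt_bracket f g \<in> K}"
proof -
  interpret Vector_Spaces.linear laurent_scale laurent_scale "\<lambda>g. witt_bracket g f"
    by (rule linear_witt_bracket)
  have flip: "witt_bracket f g \<in> K \<longleftrightarrow> witt_bracket g f \<in> K" for g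
    using laurent.subspace_neg [OF assms, of "witt_bracket f g"]
      laurent.subspace_neg [OF assms, of "witt_bracket g f"]
    by (auto simp: witt_bracket_def algebra_simps)
  show ?thesis
    unfolding flip using laurent.subspace_add [OF assms] laurent.subspace_scale [OF assms]
      laurent.subspace_0 [OF assms]
    by (intro laurent.subspaceI) (simp_all add: add scale)
qed

text \<open>
  The polynomial part of the largest ideal contained in \<open>K\<close> (its conductor).
\<close>

definition ideal_generators :: "'k::field laurent set \<Rightarrow> 'k poly set" where
  "ideal_generators K = {p. W_mult (laurent_of_poly p) \<subseteq> K}"

lemma ideal_generators_iff:
  "p \<in> ideal_generators K \<longleftrightarrow> (\<forall>g. laurent_of_poly p * g \<in> K)"
  by (auto simp: ideal_generators_def W_mult_def)

lemma ideal_generators_mult: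
  "p \<in> ideal_generators K \<Longrightarrow> q * p \<in> ideal_generators K"
  by (simp add: ideal_generators_iff laurent_of_poly_mult mult.assoc
    mult.left_commute [of "laurent_of_poly q"])

lemma ideal_generators_diff:
  assumes "laurent_subspace K" "p \<in> ideal_generators K" "q \<in> ideal_generators K"
  shows "p - q \<in> ideal_generators K"
  using assms(2,3) laurent.subspace_diff [OF assms(1)]
  by (simp add: ideal_generators_iff laurent_of_poly_diff left_diff_distrib)

lemma ideal_generators_cancel_t:
  fixes K :: "'k::field laurent set"
  assumes "monom 1 1 * p \<in> ideal_generators K"
  shows "p \<in> ideal_generators K"
  unfolding ideal_generators_iff
proof
  fix g
  have "laurent_of_poly p * g =
      laurent_of_poly (monom 1 1 * p) * (Poly_Mapping.single (- 1) 1 * g)"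
  proof -
    have "Poly_Mapping.single (1 :: int) (1 :: 'k) * Poly_Mapping.single (- 1) 1 = 1"
      by (simp add: mult_single)
    then show ?thesis
      by (simp add: laurent_of_poly_mult laurent_of_poly_monom ac_simps)
  qed
  then show "laurent_of_poly p * g \<in> K"
    using assms unfolding ideal_generators_iff by metis
qed

text \<open>
  The functionals \<open>\<Psi>\<close> below express that both \<open>f\<close> and its brackets with representatives of a finite
  spanning set of the quotient by \<open>K\<close> lie in \<open>K\<close>. Since \<open>K\<close> is closed under brackets, \<open>f\<close> then
  has its brackets with all of \<open>W\<close> in \<open>K\<close>. Two such polynomials yield an ideal.
\<close>

lemma ideal_generators_nontrivial:
  fixes K :: "'k::field_char_0 laurent set"
  assumes "witt_lie_subalgebra K" and codim: "witt_finite_codim K"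
  obtains p where "p \<noteq> 0" "p \<in> ideal_generators K"
proof -
  have sub: "laurent_subspace K"
    using assms(1) by (simp add: witt_lie_subalgebra_def)
  obtain B where "finite B" and span_B: "laurent_span (K \<union> B) = UNIV"
    using codim by (auto simp: witt_finite_codim_def)
  obtain \<Phi> where "finite \<Phi>"
    and linear_\<Phi>: "\<forall>\<phi>\<in>\<Phi>. Vector_Spaces.linear laurent_scale (*) \<phi>"
    and kernel_\<Phi>: "\<forall>f. (\<forall>\<phi>\<in>\<Phi>. \<phi> f = 0) \<longrightarrow> f \<in> K"
    by (rule finite_codim_common_kernel [OF sub codim])
  define \<Psi> where "\<Psi> = \<Phi> \<union> (\<lambda>(\<phi>, g). \<phi> \<circ> (\<lambda>f. witt_bracket f g)) ` (\<Phi> \<times> B)"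
  have "finite \<Psi>"
    using \<open>finite \<Phi>\<close> \<open>finite B\<close> by (simp add: \<Psi>_def)
  have linear_\<Psi>: "Vector_Spaces.linear laurent_scale (*) \<psi>" if "\<psi> \<in> \<Psi>" for \<psi>
    using that linear_\<Phi>
    by (auto simp: \<Psi>_def intro: Vector_Spaces.linear_compose [OF linear_witt_bracket])
  have bracket: "witt_bracket f g \<in> K" if f: "\<forall>\<psi>\<in>\<Psi>. \<psi> f = 0" for f g
  proof -
    have "f \<in> K"
      using f kernel_\<Phi> by (simp add: \<Psi>_def)
    have "witt_bracket f b \<in> K" if "b \<in> K \<union> B" for b
      using that
    proof
      assume "b \<in> B"
      then have mem: "\<phi> \<circ> (\<lambda>f. witt_bracket f b) \<in> \<Psi>" if "\<phi> \<in> \<Phi>" for \<phi>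
        using that by (auto simp: \<Psi>_def intro!: image_eqI [of _ _ "(\<phi>, b)"])
      have "\<phi> (witt_bracket f b) = 0" if "\<phi> \<in> \<Phi>" for \<phi>
        using bspec [OF f mem [OF that]] by simp
      then show ?thesis using kernel_\<Phi> by simp
    next
      assume "b \<in> K"
      then show ?thesis
        using \<open>f \<in> K\<close> assms(1) by (simp add: witt_lie_subalgebra_def)
    qed
    then have "laurent_span (K \<union> B) \<subseteq> {g. witt_bracket f g \<in> K}"
      by (intro laurent.span_minimal subspace_witt_bracket_into sub) auto
    then show ?thesis
      unfolding span_B by auto
  qed
  \<comment> \<open>The factor \<open>t\<close> makes the degree of a positive, as the Wronskian argument requires.\<close>
  obtain a where a: "a \<noteq> 0" "monom 1 1 dvd a" "\<forall>\<psi>\<in>\<Psi>. \<psi> (laurent_of_poly a) = 0"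
    using nonzero_poly_in_common_kernel [OF \<open>finite \<Psi>\<close> linear_\<Psi>] by blast
  obtain b where b: "b \<noteq> 0" "monom 1 (Suc (degree a)) dvd b"
      "\<forall>\<psi>\<in>\<Psi>. \<psi> (laurent_of_poly b) = 0"
    using nonzero_poly_in_common_kernel [OF \<open>finite \<Psi>\<close> linear_\<Psi>] by blast
  define r where "r = a * pderiv b - pderiv a * b"
  have "0 < degree a" "degree a < degree b"
    using dvd_imp_degree_le [OF a(2,1)] dvd_imp_degree_le [OF b(2,1)]
    by (simp_all add: degree_monom_eq)
  then have "r \<noteq> 0"
    unfolding r_def by (rule poly_wronskian_nonzero)
  moreover have "r \<in> ideal_generators K"
    unfolding ideal_generators_iff
  proof
    fix g
    have "2 * (laurent_of_poly r * g) \<in> K"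
      using laurent.subspace_diff [OF sub
          bracket [OF a(3), of "laurent_of_poly b * g"] bracket [OF b(3), of "laurent_of_poly a * g"]]
        witt_bracket_mult_shift [of "laurent_of_poly a" "laurent_of_poly b" g]
      by (simp add: r_def flip: witt_bracket_of_poly)
    then have "laurent_scale (1 / 2) (2 * (laurent_of_poly r * g)) \<in> K"
      by (rule laurent.subspace_scale [OF sub])
    moreover have "Poly_Mapping.single (0 :: int) (1 / 2 :: 'k) * 2 = 1"
      unfolding mult_2_right by (simp flip: single_add)
    ultimately show "laurent_of_poly r * g \<in> K"
      by (simp add: laurent_scale_def flip: mult.assoc)
  qed
  ultimately show thesis by (rule that)
qed

lemma ideal_generators_monic_generator:
  fixes K :: "'k::field_char_0 laurent set"
  assumes "witt_lie_subalgebra K" and "witt_finite_codim K"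
  obtains p where "p \<in> ideal_generators K" "lead_coeff p = 1" "poly p 0 \<noteq> 0"
    "\<And>q. q \<in> ideal_generators K \<Longrightarrow> p dvd q"
proof -
  have sub: "laurent_subspace K"
    using assms(1) by (simp add: witt_lie_subalgebra_def)
  define P where "P = (\<lambda>p. p \<noteq> 0 \<and> p \<in> ideal_generators K)"
  obtain p\<^sub>0 where "p\<^sub>0 \<noteq> 0" "p\<^sub>0 \<in> ideal_generators K"
    by (rule ideal_generators_nontrivial [OF assms])
  then have "P p\<^sub>0"
    by (simp add: P_def)
  then obtain p where "is_arg_min degree P p"
    using is_arg_min_arg_min_nat [of P p\<^sub>0 degree] by auto
  then have p: "p \<noteq> 0" "p \<in> ideal_generators K"
    and min: "\<And>q. q \<noteq> 0 \<Longrightarrow> q \<in> ideal_generators K \<Longrightarrow> degree p \<le> degree q"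
    by (auto simp: is_arg_min_linorder P_def)
  have dvd: "p dvd q" if "q \<in> ideal_generators K" for q
  proof -
    have "q - q div p * p \<in> ideal_generators K"
      by (intro ideal_generators_diff sub that ideal_generators_mult p)
    then have "q mod p \<in> ideal_generators K"
      by (simp add: minus_div_mult_eq_mod)
    then have "q mod p = 0"
      using min [of "q mod p"] degree_mod_less [OF p(1), of q] by (cases "q mod p = 0") auto
    then show ?thesis by (simp add: dvd_eq_mod_eq_0)
  qed
  define d where "d = smult (inverse (lead_coeff p)) p"
  show thesis
  proof
    show "d \<in> ideal_generators K"
      using ideal_generators_mult [OF p(2), of "[:inverse (lead_coeff p):]"] by (simp add: d_def)
    show "lead_coeff d = 1"
      using p(1) by (simp add: d_def)
    show "d dvd q" if "q \<in> ideal_generators K" for q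
      using dvd [OF that] p(1) by (simp add: d_def smult_dvd_iff)
    show "poly d 0 \<noteq> 0"
    proof
      assume "poly d 0 = 0"
      then have "poly p 0 = 0"
        using p(1) by (simp add: d_def)
      then obtain q where q: "p = [:0, 1:] * q"
        using poly_eq_0_iff_dvd [of p 0] by (auto elim: dvdE)
      then have "q \<in> ideal_generators K"
        using ideal_generators_cancel_t [of q K] p(2) by (simp add: monom_Suc)
      moreover have "q \<noteq> 0" "degree p = Suc (degree q)"
        using p(1) q by auto
      ultimately show False using min [of q] by simp
    qed
  qed
qed

section \<open>Vanishing at the roots of the generator\<close>

text \<open>
  In \<open>[k, p h] = k p' h + p (k h' - k' h)\<close> the left-hand side lies in \<open>K\<close> because \<open>K\<close> is a subalgebra,
  and the last term because it is a multiple of \<open>p\<close>; hence so does \<open>k p' h\<close>. Choosing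
  \<open>h = t\<^sup>n g\<close> removes the power of \<open>t\<close> from \<open>k\<close>.
\<close>

lemma mult_pderiv_in_ideal_generators:
  fixes K :: "'k::field laurent set"
  assumes lie: "witt_lie_subalgebra K" and p: "p \<in> ideal_generators K"
    and q: "Poly_Mapping.single (- int n) 1 * laurent_of_poly q \<in> K"
  shows "q * pderiv p \<in> ideal_generators K"
  unfolding ideal_generators_iff
proof
  fix g :: "'k laurent"
  define k where "k = Poly_Mapping.single (- int n) 1 * laurent_of_poly q"
  define h where "h = Poly_Mapping.single (int n) 1 * g"
  have sub: "laurent_subspace K" and closed: "\<And>f g. f \<in> K \<Longrightarrow> g \<in> K \<Longrightarrow> witt_bracket f g \<in> K"
    using lie by (auto simp: witt_lie_subalgebra_def)
  have p: "laurent_of_poly p * f \<in> K" for f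
    using p by (simp add: ideal_generators_iff)
  have "k * laurent_of_poly (pderiv p) * h = witt_bracket k (laurent_of_poly p * h) -
      laurent_of_poly p * (k * laurent_deriv h - laurent_deriv k * h)"
    by (simp add: witt_bracket_def laurent_deriv_mult laurent_deriv_of_poly algebra_simps)
  moreover have "\<dots> \<in> K"
    by (intro laurent.subspace_diff sub closed p) (use q in \<open>simp add: k_def\<close>)
  moreover have "k * laurent_of_poly (pderiv p) * h = laurent_of_poly (q * pderiv p) * g"
  proof -
    have "Poly_Mapping.single (- int n) (1 :: 'k) * Poly_Mapping.single (int n) 1 = 1"
      by (simp add: mult_single)
    then show ?thesis
      by (simp add: k_def h_def laurent_of_poly_mult ac_simps)
  qed
  ultimately show "laurent_of_poly (q * pderiv p) * g \<in> K" by simp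
qed

text \<open>
  If \<open>q\<close> did not vanish at \<open>x\<close>, then \<open>q p'\<close> would have the order of \<open>p'\<close> there, one less than that of
  \<open>p\<close>.
\<close>

lemma poly_root_of_dvd_mult_pderiv:
  fixes p q :: "'k::field_char_0 poly"
  assumes "p \<noteq> 0" "poly p x = 0" "p dvd q * pderiv p"
  shows "poly q x = 0"
proof (rule ccontr)
  assume q: "poly q x \<noteq> 0"
  have "degree p \<noteq> 0"
  proof
    assume "degree p = 0"
    then obtain c where "p = [:c:]" by (rule degree_eq_zeroE)
    then show False using assms(1,2) by simp
  qed
  then have nz: "q * pderiv p \<noteq> 0"
    using q by (auto simp: pderiv_eq_0_iff)
  then have "order x p \<le> order x q + order x (pderiv p)"
    using dvd_imp_order_le [OF _ assms(3)] by (simp add: order_mult)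
  then show False
    using order_pderiv [OF assms(1,2)] q by (simp add: order_0I)
qed

lemma prod_linear_factors_dvd:
  fixes q :: "'k::field poly"
  assumes "finite A" "\<And>x. x \<in> A \<Longrightarrow> poly q x = 0"
  shows "(\<Prod>x\<in>A. [:- x, 1:]) dvd q"
  using assms
proof (induction A rule: finite_induct)
  case (insert x A)
  then obtain r where r: "q = (\<Prod>y\<in>A. [:- y, 1:]) * r"
    by (auto elim: dvdE)
  have "poly (\<Prod>y\<in>A. [:- y, 1:]) x \<noteq> 0"
    using insert.hyps by (auto simp: poly_prod)
  then have "[:- x, 1:] dvd r"
    using insert.prems [of x] by (simp add: r poly_eq_0_iff_dvd)
  then have "[:- x, 1:] * (\<Prod>y\<in>A. [:- y, 1:]) dvd r * (\<Prod>y\<in>A. [:- y, 1:])"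
    by (rule mult_dvd_mono) simp
  then show ?case
    by (simp only: prod.insert [OF insert.hyps] r mult.commute [of r])
qed simp

lemma monic_generator_rad_sandwich:
  fixes K :: "'k::field_char_0 laurent set"
  assumes lie: "witt_lie_subalgebra K" and p: "p \<in> ideal_generators K" "poly p 0 \<noteq> 0"
    and gen: "\<And>q. q \<in> ideal_generators K \<Longrightarrow> p dvd q"
  shows "rad_sandwich K (laurent_of_poly p)"
proof -
  have "p \<noteq> 0" using p(2) by auto
  have "k \<in> W_mult (laurent_rad (laurent_of_poly p))" if "k \<in> K" for k
  proof -
    obtain n q where k: "k = Poly_Mapping.single (- int n) 1 * laurent_of_poly q"
      by (rule laurent_eq_single_mult_of_poly)
    have "p dvd q * pderiv p"
      using mult_pderiv_in_ideal_generators [OF lie p(1)] \<open>k \<in> K\<close> k gen by blast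
    then have "(\<Prod>x | poly p x = 0. [:- x, 1:]) dvd q"
      using poly_roots_finite [OF \<open>p \<noteq> 0\<close>] poly_root_of_dvd_mult_pderiv [OF \<open>p \<noteq> 0\<close>]
      by (intro prod_linear_factors_dvd) auto
    then obtain s where "q = (\<Prod>x | poly p x = 0. [:- x, 1:]) * s"
      by (auto elim: dvdE)
    then have "k = laurent_rad (laurent_of_poly p) *
        (Poly_Mapping.single (- int n) 1 * laurent_of_poly s)"
      by (simp add: k laurent_rad_of_poly p(2) laurent_of_poly_mult ac_simps)
    then show ?thesis by (auto simp: W_mult_def)
  qed
  then show ?thesis
    using p(1) \<open>p \<noteq> 0\<close> by (auto simp: rad_sandwich_def ideal_generators_def)
qed

theorem proposition3p2p7:
  fixes K :: "'k::{alg_closed_field, field_char_0} laurent set"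
  assumes "uncountable (UNIV :: 'k set)"
    and "witt_lie_subalgebra K"
    and "witt_finite_codim K"
  shows "(\<exists>f. rad_sandwich K f) \<and>
    (\<exists>p. normalized_rad_sandwich K p) \<and>
    (\<exists>!p. is_arg_min degree (normalized_rad_sandwich K) p)"
proof -
  obtain p where p: "p \<in> ideal_generators K" "lead_coeff p = 1" "poly p 0 \<noteq> 0"
      "\<And>q. q \<in> ideal_generators K \<Longrightarrow> p dvd q"
    by (rule ideal_generators_monic_generator [OF assms(2,3), of thesis], rule that)
  have sandwich: "rad_sandwich K (laurent_of_poly p)"
    by (intro monic_generator_rad_sandwich assms p)
  then have norm: "normalized_rad_sandwich K p"
    using p by (simp add: normalized_rad_sandwich_def)
  have dvd: "p dvd q" "q \<noteq> 0" "lead_coeff q = 1" if "normalized_rad_sandwich K q" for q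
    using that p(4) [of q]
    by (simp_all add: normalized_rad_sandwich_def rad_sandwich_def ideal_generators_def)
  then have least: "degree p \<le> degree q" if "normalized_rad_sandwich K q" for q
    using that by (blast intro: dvd_imp_degree_le)
  have "\<exists>!p. is_arg_min degree (normalized_rad_sandwich K) p"
  proof (rule ex1I)
    show "is_arg_min degree (normalized_rad_sandwich K) p"
      by (simp add: is_arg_min_linorder norm least)
    fix q
    assume "is_arg_min degree (normalized_rad_sandwich K) q"
    then have q: "normalized_rad_sandwich K q" "degree q \<le> degree p"
      by (auto simp: is_arg_min_linorder norm)
    obtain r where r: "q = p * r"
      using dvd(1) [OF q(1)] by (auto elim: dvdE)
    then have "p \<noteq> 0" "r \<noteq> 0"
      using dvd(2) [OF q(1)] by auto
    then have "degree r = 0"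
      using q(2) r by (simp add: degree_mult_eq)
    moreover have "lead_coeff r = 1"
      using dvd(3) [OF q(1)] p(2) r by (simp add: lead_coeff_mult)
    ultimately have "r = 1"
      by (auto elim!: degree_eq_zeroE simp: one_pCons)
    then show "q = p" by (simp add: r)
  qed
  then show ?thesis
    by (intro conjI exI [of _ "laurent_of_poly p"] exI [of _ p] sandwich norm)
qed

end
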